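(* For any polynomial $p=\sum_\alpha c_\alpha x^\alpha\in\mathbb{R}[x_1,\dots,x_n]$ of degree at most $m$, where $m\ge2$, and any nonempty compact convex set $S\subseteq[0,1]^n$, $$z^*_S-z^{mono}_S\le \max_\alpha|c_\alpha|\,\Big(1-\frac1m\Big)m^{\frac1{1-m}}\binom{n+m}{n}.$$
   Context: $z^*_S:=\min\{p(x)\mid x\in S\}$. The sum defining $p$ is finite, over exponents $\alpha\in\mathbb{Z}_{\ge0}^n$ with $\sum_j\alpha_j\le m$. Monomial convexification bound: for each monomial $x^\alpha$ appearing in $p$, let $J_\alpha=\{j\mid\alpha_j\ge1\}$, let $x_{J_\alpha}$ be the subvector of the variables appearing in the monomial, and let $$H_\alpha:=\operatorname{conv}\Big\{\big(x_{J_\alpha},\,x^\alpha\big)\;\Big|\; x\in S\Big\}$$ be the convex hull of the graph of the monomial. Then $$z^{mono}_S:=\min\Big\{\sum_\alpha c_\alpha w_\alpha\;\Big|\; x\in S,\ (x_{J_\alpha},w_\alpha)\in H_\alpha\ \text{ for all }\alpha\Big\}.$$ *)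

theory Defs
  imports "HOL-Analysis.Analysis" "HOL-Library.Poly_Mapping"
begin

text \<open>
  Exponent vectors are of type \<^typ>\<open>'n \<Rightarrow>\<^sub>0 nat\<close>, and the polynomial ring over the reals in
  variables indexed by the finite type \<^typ>\<open>'n\<close> is \<^typ>\<open>('n \<Rightarrow>\<^sub>0 nat) \<Rightarrow>\<^sub>0 real\<close>.
  For such a polynomial \<open>p\<close>, the set \<open>Poly_Mapping.keys p\<close> consists of the exponents of the monomials
  appearing in \<open>p\<close>, and \<open>Poly_Mapping.lookup p \<alpha>\<close> is the coefficient of the monomial with exponent \<open>\<alpha>\<close>.
\<close>

type_synonym 'n expo = "'n \<Rightarrow>\<^sub>0 nat"
type_synonym 'n rpoly = "('n \<Rightarrow>\<^sub>0 nat) \<Rightarrow>\<^sub>0 real"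

definition expo_deg :: "'n::finite expo \<Rightarrow> nat" where
  "expo_deg \<alpha> = (\<Sum>j\<in>UNIV. Poly_Mapping.lookup \<alpha> j)"

definition degree_at_most :: "nat \<Rightarrow> 'n::finite rpoly \<Rightarrow> bool" where
  "degree_at_most m p \<longleftrightarrow> (\<forall>\<alpha>\<in>Poly_Mapping.keys p. expo_deg \<alpha> \<le> m)"

definition monomial_at :: "'n::finite expo \<Rightarrow> real ^ 'n \<Rightarrow> real" where
  "monomial_at \<alpha> x = (\<Prod>j\<in>UNIV. (x $ j) ^ Poly_Mapping.lookup \<alpha> j)"

definition poly_at :: "'n::finite rpoly \<Rightarrow> real ^ 'n \<Rightarrow> real" where
  "poly_at p x = (\<Sum>\<alpha>\<in>Poly_Mapping.keys p. Poly_Mapping.lookup p \<alpha> * monomial_at \<alpha> x)"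

text \<open>
  The subvector of \<open>x\<close> with index set \<open>J\<close>. It is kept inside the full space by padding with
  zeros outside \<open>J\<close>; this identifies \<open>\<real>\<^sup>J\<close> with a coordinate subspace of the full space,
  which preserves convex hulls.
\<close>

definition subvec :: "'n set \<Rightarrow> real ^ 'n \<Rightarrow> real ^ 'n" where
  "subvec J x = (\<chi> j. if j \<in> J then x $ j else 0)"

text \<open>
  Here \<open>Poly_Mapping.keys \<alpha>\<close> is the set of those \<open>j\<close> with \<open>\<alpha>\<^sub>j \<ge> 1\<close>.
\<close>

definition graph_hull :: "(real ^ 'n) set \<Rightarrow> 'n::finite expo \<Rightarrow> ((real ^ 'n) \<times> real) set" where
  "graph_hull S \<alpha> = convex hull {(subvec (Poly_Mapping.keys \<alpha>) x, monomial_at \<alpha> x) | x. x \<in> S}"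

text \<open>
  Minima are least elements of the set of objective values, not infima, so the two values below
  are meaningful only when the minimum is attained; this is the case for nonempty compact \<open>S\<close>.
\<close>

definition z_opt :: "(real ^ 'n) set \<Rightarrow> 'n::finite rpoly \<Rightarrow> real" where
  "z_opt S p = (LEAST z. z \<in> {poly_at p x | x. x \<in> S})"

definition z_mono :: "(real ^ 'n) set \<Rightarrow> 'n::finite rpoly \<Rightarrow> real" where
  "z_mono S p = (LEAST z. z \<in> {\<Sum>\<alpha>\<in>Poly_Mapping.keys p. Poly_Mapping.lookup p \<alpha> * w \<alpha> | x w.
     x \<in> S \<and> (\<forall>\<alpha>\<in>Poly_Mapping.keys p. (subvec (Poly_Mapping.keys \<alpha>) x, w \<alpha>) \<in> graph_hull S \<alpha>)})"

text \<open>
  The maximum runs over all exponents of degree at most \<open>m\<close>, including those with coefficient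
  zero, so that it is also defined for the zero polynomial.
\<close>

definition max_abs_coeff :: "nat \<Rightarrow> 'n::finite rpoly \<Rightarrow> real" where
  "max_abs_coeff m p = Max {\<bar>Poly_Mapping.lookup p \<alpha>\<bar> | \<alpha>. expo_deg \<alpha> \<le> m}"

end

theory Submission
  imports Defs
begin

text \<open>
  Let \<open>x \<in> S\<close> and \<open>(x\<^sub>J, w) \<in> H\<^sub>\<alpha>\<close>. Being a convex combination of points on the graph of the monomial,
  \<open>w\<close> satisfies every affine bound valid for \<open>x\<^sup>\<alpha>\<close> on the cube: with \<open>t = min\<^sub>J x\<^sub>j\<close> and
  \<open>u = \<Sum>\<^sub>j \<alpha>\<^sub>j (1 - x\<^sub>j)\<close>, it lies between \<open>max 0 (1 - u)\<close> and \<open>t\<close>. Since \<open>x\<^sup>\<alpha> \<ge> t\<^sup>m\<close>, the overestimation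
  \<open>w - x\<^sup>\<alpha>\<close> is at most \<open>C = max\<^sub>t (t - t\<^sup>m)\<close>, which is the constant of the theorem. By AM-GM
  \<open>x\<^sup>\<alpha> \<le> (1 - u/m)\<^sup>m\<close>, so the underestimation is largest at \<open>u = 1\<close> and at most \<open>(1 - 1/m)\<^sup>m\<close>, which
  Bernoulli's inequality bounds by \<open>C\<close>. Summing \<open>\<bar>c\<^sub>\<alpha>\<bar> C\<close> over the at most \<open>n + m\<close> choose \<open>n\<close> monomials, at a
  minimiser of the relaxation, gives the bound.
\<close>

section \<open>Bounds for products of powers on the unit cube\<close>

text \<open>By Bernoulli each factor lies above its tangent at 1. Factors combine through
  \<open>(1 - a) * (1 - b) \<ge> 0\<close>, that is \<open>a * b \<ge> a + b - 1\<close>.\<close>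

lemma prod_power_ge_linear:
  fixes x :: "'a \<Rightarrow> real"
  assumes "finite A" "\<And>j. j \<in> A \<Longrightarrow> 0 \<le> x j" "\<And>j. j \<in> A \<Longrightarrow> x j \<le> 1"
  shows "1 - (\<Sum>j\<in>A. real (k j) * (1 - x j)) \<le> (\<Prod>j\<in>A. x j ^ k j)"
  using assms
proof (induction A rule: finite_induct)
  case (insert a A)
  define P where "P = (\<Prod>j\<in>A. x j ^ k j)"
  have P: "0 \<le> P" "P \<le> 1"
    unfolding P_def using insert.prems by (auto intro!: prod_nonneg prod_le_1 power_le_one)
  have IH: "1 - (\<Sum>j\<in>A. real (k j) * (1 - x j)) \<le> P"
    unfolding P_def using insert by auto
  have "1 + real (k a) * (x a - 1) \<le> (1 + (x a - 1)) ^ k a"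
    using insert.prems by (intro Bernoulli_inequality) auto
  then have B: "1 - real (k a) * (1 - x a) \<le> x a ^ k a"
    by (simp add: algebra_simps)
  have "x a ^ k a \<le> 1"
    using insert.prems by (auto intro: power_le_one)
  then have "0 \<le> (1 - x a ^ k a) * (1 - P)"
    using P by (intro mult_nonneg_nonneg) auto
  then have "x a ^ k a + P - 1 \<le> x a ^ k a * P"
    by (simp add: algebra_simps)
  then show ?case
    using insert.hyps IH B unfolding P_def by simp
qed simp

text \<open>
  AM-GM with \<open>m - (\<Sum>j\<in>A. k j)\<close> additional factors \<open>1\<close>, in Polya's form: multiply
  \<open>x j / s \<le> exp (x j / s - 1)\<close> over all factors.
\<close>

lemma prod_power_le_exp:
  fixes x :: "'a \<Rightarrow> real"
  assumes "finite A" "\<And>j. j \<in> A \<Longrightarrow> 0 \<le> x j" "(\<Sum>j\<in>A. k j) \<le> m" "s > 0"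
  shows "(\<Prod>j\<in>A. x j ^ k j) \<le> s ^ m * exp ((real m - (\<Sum>j\<in>A. real (k j) * (1 - x j))) / s - real m)"
proof -
  define d where "d = (\<Sum>j\<in>A. k j)"
  have le_exp: "t / s \<le> exp (t / s - 1)" for t
    using exp_ge_add_one_self[of "t / s - 1"] by simp
  have "(\<Prod>j\<in>A. (x j / s) ^ k j) * (1 / s) ^ (m - d)
      \<le> (\<Prod>j\<in>A. exp (x j / s - 1) ^ k j) * exp (1 / s - 1) ^ (m - d)"
    using assms le_exp
    by (intro mult_mono prod_mono conjI power_mono prod_nonneg zero_le_power ballI) auto
  also have "\<dots> = exp ((\<Sum>j\<in>A. real (k j) * (x j / s - 1)) + real (m - d) * (1 / s - 1))"
    using assms(1) by (simp add: exp_add exp_sum exp_of_nat_mult)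
  also have "(\<Sum>j\<in>A. real (k j) * (x j / s - 1)) + real (m - d) * (1 / s - 1)
      = (real m - (\<Sum>j\<in>A. real (k j) * (1 - x j))) / s - real m"
  proof -
    have *: "real (m - d) = real m - (\<Sum>j\<in>A. real (k j))"
      using assms(3) unfolding d_def by simp
    have "(\<Sum>j\<in>A. real (k j) * (x j / s - 1)) = (\<Sum>j\<in>A. real (k j) * x j) / s - (\<Sum>j\<in>A. real (k j))"
      by (simp add: algebra_simps sum_subtractf sum_divide_distrib)
    then show ?thesis
      unfolding * using \<open>s > 0\<close>
      by (simp add: field_simps sum_subtractf)
  qed
  finally have main: "(\<Prod>j\<in>A. (x j / s) ^ k j) * (1 / s) ^ (m - d)
      \<le> exp ((real m - (\<Sum>j\<in>A. real (k j) * (1 - x j))) / s - real m)" .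
  have "(\<Prod>j\<in>A. (x j / s) ^ k j) * (1 / s) ^ (m - d) = (\<Prod>j\<in>A. x j ^ k j) / s ^ m"
  proof -
    have "(\<Prod>j\<in>A. (x j / s) ^ k j) = (\<Prod>j\<in>A. x j ^ k j) / s ^ d"
      unfolding d_def by (simp add: power_divide prod_dividef power_sum)
    moreover have "s ^ m = s ^ d * s ^ (m - d)"
      using assms(3) unfolding d_def by (simp flip: power_add)
    ultimately show ?thesis
      by (simp add: power_divide)
  qed
  with main have "(\<Prod>j\<in>A. x j ^ k j) / s ^ m
      \<le> exp ((real m - (\<Sum>j\<in>A. real (k j) * (1 - x j))) / s - real m)"
    by simp
  with \<open>s > 0\<close> show ?thesis
    by (simp add: pos_divide_le_eq mult.commute)
qed

text \<open>The free parameter \<open>s\<close> of \<open>prod_power_le_exp\<close> replaces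
  calculus in \<open>u\<close>: \<open>s = r\<close> serves \<open>u \<ge> 1\<close>, where
  \<open>w\<close> is bounded below by 0, and the mean \<open>s = 1 - u / m\<close> serves
  \<open>u < 1\<close>, where the affine bound on \<open>w\<close> is used.\<close>

lemma prod_power_gap:
  fixes x :: "'a \<Rightarrow> real"
  assumes "finite A" "\<And>j. j \<in> A \<Longrightarrow> 0 \<le> x j" "\<And>j. j \<in> A \<Longrightarrow> x j \<le> 1"
    and "(\<Sum>j\<in>A. k j) \<le> m" "m \<ge> 2"
    and "0 \<le> w" "1 - (\<Sum>j\<in>A. real (k j) * (1 - x j)) \<le> w"
  shows "(\<Prod>j\<in>A. x j ^ k j) - w \<le> (1 - 1 / real m) ^ m"
proof -
  define u where "u = (\<Sum>j\<in>A. real (k j) * (1 - x j))"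
  define r where "r = 1 - 1 / real m"
  have r: "0 < r" "r \<le> 1" "real m * r = real m - 1"
    using \<open>m \<ge> 2\<close> unfolding r_def by (auto simp: field_simps)
  have "u \<ge> 0"
    unfolding u_def using assms(3) by (intro sum_nonneg) auto
  have bound: "(\<Prod>j\<in>A. x j ^ k j) \<le> s ^ m * exp ((real m - u) / s - real m)" if "s > 0" for s
    unfolding u_def using assms(1,2,4) that by (rule prod_power_le_exp)
  show ?thesis
  proof (cases "u \<ge> 1")
    case True
    \<comment> \<open>\<open>m - u \<le> m - 1 = m * r\<close>, so the exponential factor is at most
      1.\<close>
    then have "(real m - u) / r \<le> real m"
      using r by (simp add: field_simps)
    then have "r ^ m * exp ((real m - u) / r - real m) \<le> r ^ m"
      using r by (intro mult_left_le) auto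
    then show ?thesis
      using bound[OF r(1)] \<open>0 \<le> w\<close> unfolding r_def[symmetric] by linarith
  next
    case False
    define s where "s = 1 - u / real m"
    have s: "0 < s" "s \<le> 1" "real m * s = real m - u"
      using False \<open>u \<ge> 0\<close> \<open>m \<ge> 2\<close> unfolding s_def by (auto simp: field_simps)
    have "(real m - u) / s - real m = 0"
      using s by (simp add: field_simps)
    then have "(\<Prod>j\<in>A. x j ^ k j) \<le> s ^ m"
      using bound[of s] s by simp
    moreover have "s ^ m - r ^ m \<le> 1 - u"
    proof -
      \<comment> \<open>The power \<open>t ^ m\<close> is \<open>m\<close>-Lipschitz on the unit
        interval; the factor \<open>m\<close> cancels the denominator of
        \<open>s - r\<close>.\<close>
      have "norm (s ^ m - r ^ m) \<le> real m * norm (s - r)"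
        using r s by (intro norm_power_diff) auto
      moreover have "s - r = (1 - u) / real m"
        unfolding s_def r_def by (simp add: diff_divide_distrib)
      ultimately show ?thesis
        using False \<open>m \<ge> 2\<close> by (simp add: abs_if split: if_splits)
    qed
    ultimately show ?thesis
      using assms(7) unfolding r_def[symmetric] u_def by linarith
  qed
qed

section \<open>The constant of the bound\<close>

text \<open>
  The maximum of \<open>t - t ^ m\<close> is attained at \<open>t = q = m powr (1 / (1 - m))\<close>, where \<open>m * q ^ (m - 1) = 1\<close>;
  the inequality is the tangent inequality for \<open>t ^ m\<close> at \<open>q\<close>.
\<close>

lemma diff_power_le:
  fixes t :: real
  assumes "m \<ge> 2" "0 \<le> t"
  shows "t - t ^ m \<le> (1 - 1 / real m) * real m powr (1 / (1 - real m))"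
proof -
  define q where "q = real m powr (1 / (1 - real m))"
  have "q > 0"
    using assms unfolding q_def by simp
  have "q ^ (m - 1) = real m powr (1 / (1 - real m) * real (m - 1))"
    using \<open>q > 0\<close> assms unfolding q_def by (simp add: powr_powr flip: powr_realpow)
  also have "1 / (1 - real m) * real (m - 1) = - 1"
    using assms by (simp add: of_nat_diff field_simps)
  finally have "q ^ (m - 1) = 1 / real m"
    using assms by (simp add: powr_minus_divide)
  moreover have "q ^ m = q * q ^ (m - 1)"
    using assms by (simp flip: power_Suc)
  ultimately have qm: "q ^ m = q / real m"
    by simp
  have "1 + real m * (t / q - 1) \<le> (1 + (t / q - 1)) ^ m"
    using assms \<open>q > 0\<close> by (intro Bernoulli_inequality) auto
  then have "1 + real m * (t / q - 1) \<le> t ^ m / q ^ m"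
    by (simp add: power_divide)
  then have "(1 + real m * (t / q - 1)) * q ^ m \<le> t ^ m"
    using \<open>q > 0\<close> by (simp add: field_simps)
  moreover have "(1 + real m * (t / q - 1)) * q ^ m = q / real m + t - q"
    unfolding qm using \<open>q > 0\<close> assms by (simp add: field_simps)
  ultimately show ?thesis
    unfolding q_def[symmetric] by (simp add: algebra_simps)
qed

text \<open>Apply \<open>diff_power_le\<close> at \<open>t = r ^ (m - 1)\<close>: since
  \<open>t ^ (m - 1) \<le> 1 / m\<close>, the difference \<open>t - t ^ m\<close> is at least
  \<open>t * r = r ^ m\<close>.\<close>

lemma power_one_minus_inverse_le:
  assumes "m \<ge> 2"
  shows "(1 - 1 / real m) ^ m \<le> (1 - 1 / real m) * real m powr (1 / (1 - real m))"
proof -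
  define r where "r = 1 - 1 / real m"
  define t where "t = r ^ (m - 1)"
  have r: "0 < r" "1 / r = 1 + 1 / real (m - 1)"
    using assms unfolding r_def by (auto simp: field_simps of_nat_diff)
  \<comment> \<open>The exponent is that of \<open>r\<close> in \<open>t ^ (m - 1)\<close>; the left
    side equals \<open>m\<close>.\<close>
  have "1 + real ((m - 1) * (m - 1)) * (1 / real (m - 1)) \<le> (1 + 1 / real (m - 1)) ^ ((m - 1) * (m - 1))"
    by (intro Bernoulli_inequality) (simp add: order_trans[of _ 0])
  then have "real m \<le> (1 / r) ^ ((m - 1) * (m - 1))"
    unfolding r(2) using assms by (simp add: of_nat_diff)
  then have "r ^ ((m - 1) * (m - 1)) \<le> 1 / real m"
    using r(1) assms by (simp add: power_one_over le_divide_eq mult.commute)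
  then have *: "t ^ (m - 1) \<le> 1 / real m"
    unfolding t_def by (simp add: power_mult)
  have "t * (1 - 1 / real m) \<le> t * (1 - t ^ (m - 1))"
    using * r unfolding t_def by (intro mult_left_mono) auto
  also have "\<dots> = t - t ^ m"
    using assms by (simp add: algebra_simps flip: power_Suc)
  also have "\<dots> \<le> (1 - 1 / real m) * real m powr (1 / (1 - real m))"
    using assms r unfolding t_def by (intro diff_power_le) auto
  finally show ?thesis
    using assms unfolding t_def r_def[symmetric] by (simp flip: power_Suc2)
qed

section \<open>Convex hulls of monomial graphs\<close>

lemma monomial_at_bounds:
  assumes "x \<in> cbox 0 1"
  shows "0 \<le> monomial_at \<alpha> x" "monomial_at \<alpha> x \<le> 1"
    and "j \<in> Poly_Mapping.keys \<alpha> \<Longrightarrow> monomial_at \<alpha> x \<le> x $ j"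
proof -
  have x: "0 \<le> x $ i" "x $ i \<le> 1" for i
    using assms by (auto simp: mem_box_cart)
  show "0 \<le> monomial_at \<alpha> x" "monomial_at \<alpha> x \<le> 1"
    unfolding monomial_at_def using x by (auto intro!: prod_nonneg prod_le_1 power_le_one)
  assume "j \<in> Poly_Mapping.keys \<alpha>"
  then have "Poly_Mapping.lookup \<alpha> j \<noteq> 0"
    by (simp add: in_keys_iff)
  then have "(x $ j) ^ Poly_Mapping.lookup \<alpha> j \<le> (x $ j) ^ 1"
    using x by (intro power_decreasing) auto
  moreover have "(\<Prod>i\<in>UNIV - {j}. (x $ i) ^ Poly_Mapping.lookup \<alpha> i) \<le> 1"
    using x by (auto intro!: prod_le_1 power_le_one)
  ultimately have "(x $ j) ^ Poly_Mapping.lookup \<alpha> j * (\<Prod>i\<in>UNIV - {j}. (x $ i) ^ Poly_Mapping.lookup \<alpha> i)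
      \<le> x $ j * 1"
    using x by (intro mult_mono) (auto intro!: prod_nonneg)
  then show "monomial_at \<alpha> x \<le> x $ j"
    unfolding monomial_at_def by (subst prod.remove[of UNIV j]) auto
qed

text \<open>
  The right-hand sides are the standard affine minorants and majorants of a monomial on the cube;
  being affine, they pass to the convex hull.
\<close>

lemma graph_hull_subset:
  assumes "S \<subseteq> cbox 0 1"
  shows "graph_hull S \<alpha> \<subseteq>
    {v. 0 \<le> snd v \<and> snd v \<le> 1 \<and> (\<forall>j\<in>Poly_Mapping.keys \<alpha>. snd v \<le> fst v $ j)
      \<and> 1 - (\<Sum>j\<in>UNIV. real (Poly_Mapping.lookup \<alpha> j) * (1 - fst v $ j)) \<le> snd v}"
    (is "_ \<subseteq> ?H")
  unfolding graph_hull_def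
proof (rule hull_minimal)
  show "{(subvec (Poly_Mapping.keys \<alpha>) x, monomial_at \<alpha> x) |x. x \<in> S} \<subseteq> ?H"
  proof
    fix v assume "v \<in> {(subvec (Poly_Mapping.keys \<alpha>) x, monomial_at \<alpha> x) |x. x \<in> S}"
    then obtain x where v: "v = (subvec (Poly_Mapping.keys \<alpha>) x, monomial_at \<alpha> x)" and "x \<in> S"
      by blast
    with assms have x: "x \<in> cbox 0 1"
      by blast
    \<comment> \<open>Padding with zeros is harmless: coordinates outside the support carry weight
      0.\<close>
    have "(\<Sum>j\<in>UNIV. real (Poly_Mapping.lookup \<alpha> j) * (1 - subvec (Poly_Mapping.keys \<alpha>) x $ j))
        = (\<Sum>j\<in>UNIV. real (Poly_Mapping.lookup \<alpha> j) * (1 - x $ j))"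
      by (intro sum.cong) (auto simp: subvec_def in_keys_iff)
    moreover have "1 - (\<Sum>j\<in>UNIV. real (Poly_Mapping.lookup \<alpha> j) * (1 - x $ j)) \<le> monomial_at \<alpha> x"
      unfolding monomial_at_def using x by (intro prod_power_ge_linear) (auto simp: mem_box_cart)
    ultimately show "v \<in> ?H"
      using monomial_at_bounds[OF x, where \<alpha> = \<alpha>] unfolding v by (auto simp: subvec_def)
  qed
  show "convex ?H"
  proof (rule convexI)
    fix Y Z :: "(real ^ 'a) \<times> real" and a b :: real
    assume YZ: "Y \<in> ?H" "Z \<in> ?H" and ab: "0 \<le> a" "0 \<le> b" "a + b = 1"
    obtain y v z w where [simp]: "Y = (y, v)" "Z = (z, w)"
      by fastforce
    have v: "0 \<le> v" "v \<le> 1" and w: "0 \<le> w" "w \<le> 1"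
      and y: "\<forall>j\<in>Poly_Mapping.keys \<alpha>. v \<le> y $ j" and z: "\<forall>j\<in>Poly_Mapping.keys \<alpha>. w \<le> z $ j"
      and y': "1 - (\<Sum>j\<in>UNIV. real (Poly_Mapping.lookup \<alpha> j) * (1 - y $ j)) \<le> v"
      and z': "1 - (\<Sum>j\<in>UNIV. real (Poly_Mapping.lookup \<alpha> j) * (1 - z $ j)) \<le> w"
      using YZ by simp_all
    have 1: "0 \<le> a * v + b * w"
      using ab v w by simp
    have 2: "a * v + b * w \<le> 1"
      using ab v w convex_bound_le by blast
    have 3: "a * v + b * w \<le> a * y $ j + b * z $ j" if "j \<in> Poly_Mapping.keys \<alpha>" for j
      using that y z ab by (intro add_mono mult_left_mono) auto
    have b: "b = 1 - a"
      using ab(3) by simp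
    have "k * (1 - (a * y $ j + b * z $ j)) = a * (k * (1 - y $ j)) + b * (k * (1 - z $ j))" for j k
      unfolding b by (simp add: algebra_simps)
    \<comment> \<open>The affine minorant respects convex combinations once its constant 1 is split
      as \<open>a + b\<close>.\<close>
    then have "1 - (\<Sum>j\<in>UNIV. real (Poly_Mapping.lookup \<alpha> j) * (1 - (a * y $ j + b * z $ j)))
       = (a + b) - (\<Sum>j\<in>UNIV. a * (real (Poly_Mapping.lookup \<alpha> j) * (1 - y $ j))
                        + b * (real (Poly_Mapping.lookup \<alpha> j) * (1 - z $ j)))"
      using ab(3) by (simp only:)
    also have "\<dots> = a * (1 - (\<Sum>j\<in>UNIV. real (Poly_Mapping.lookup \<alpha> j) * (1 - y $ j)))
        + b * (1 - (\<Sum>j\<in>UNIV. real (Poly_Mapping.lookup \<alpha> j) * (1 - z $ j)))"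
      by (simp only: sum.distrib sum_distrib_left[symmetric]) (simp add: algebra_simps)
    also have "\<dots> \<le> a * v + b * w"
      using y' z' ab by (intro add_mono mult_left_mono) auto
    finally show "a *\<^sub>R Y + b *\<^sub>R Z \<in> ?H"
      using 1 2 3 by simp
  qed
qed

text \<open>Underestimation is \<open>prod_power_gap\<close>. For overestimation \<open>w\<close>
  itself replaces the minimal coordinate: it lies below every \<open>x $ j\<close> on the support,
  so the monomial is at least \<open>w ^ expo_deg \<alpha> \<ge> w ^ m\<close>.\<close>

lemma graph_hull_gap:
  assumes "S \<subseteq> cbox 0 1" "x \<in> cbox 0 1" "m \<ge> 2" "expo_deg \<alpha> \<le> m"
    and hull: "(subvec (Poly_Mapping.keys \<alpha>) x, w) \<in> graph_hull S \<alpha>"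
  shows "\<bar>monomial_at \<alpha> x - w\<bar> \<le> (1 - 1 / real m) * real m powr (1 / (1 - real m))" (is "_ \<le> ?C")
proof -
  let ?J = "Poly_Mapping.keys \<alpha>"
  have x: "0 \<le> x $ j" "x $ j \<le> 1" for j
    using assms(2) by (auto simp: mem_box_cart)
  have eq: "(\<Sum>j\<in>UNIV. real (Poly_Mapping.lookup \<alpha> j) * (1 - subvec ?J x $ j))
      = (\<Sum>j\<in>UNIV. real (Poly_Mapping.lookup \<alpha> j) * (1 - x $ j))"
    by (intro sum.cong) (auto simp: subvec_def in_keys_iff)
  have w: "0 \<le> w" "w \<le> 1" "\<And>j. j \<in> ?J \<Longrightarrow> w \<le> x $ j"
    "1 - (\<Sum>j\<in>UNIV. real (Poly_Mapping.lookup \<alpha> j) * (1 - x $ j)) \<le> w"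
    using graph_hull_subset[OF assms(1)] hull eq by (fastforce simp: subvec_def)+
  have "monomial_at \<alpha> x - w \<le> (1 - 1 / real m) ^ m"
    unfolding monomial_at_def using x w assms(3,4)
    by (intro prod_power_gap) (auto simp: expo_deg_def)
  then have lower: "monomial_at \<alpha> x - w \<le> ?C"
    using power_one_minus_inverse_le[OF assms(3)] by linarith
  have "w ^ m \<le> w ^ expo_deg \<alpha>"
    using w assms(4) by (intro power_decreasing) auto
  also have "\<dots> = (\<Prod>j\<in>UNIV. w ^ Poly_Mapping.lookup \<alpha> j)"
    unfolding expo_deg_def by (simp add: power_sum)
  also have "\<dots> \<le> monomial_at \<alpha> x"
    unfolding monomial_at_def
  proof (intro prod_mono conjI zero_le_power w)
    \<comment> \<open>Off the support the exponent is 0 and both powers are 1.\<close>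
    show "w ^ Poly_Mapping.lookup \<alpha> j \<le> (x $ j) ^ Poly_Mapping.lookup \<alpha> j" for j
      using w by (cases "j \<in> ?J") (auto intro: power_mono simp: in_keys_iff)
  qed
  finally have "w - monomial_at \<alpha> x \<le> w - w ^ m"
    by simp
  also have "\<dots> \<le> ?C"
    using assms(3) w by (intro diff_power_le)
  finally show ?thesis
    using lower by linarith
qed

section \<open>Attainment of the two minima\<close>

lemma continuous_on_subvec: "continuous_on A (subvec (J :: 'a::finite set))"
proof -
  have "continuous_on A (\<lambda>x. if j \<in> J then x $ j else 0)" for j :: 'a
    by (cases "j \<in> J") (auto intro!: continuous_intros)
  then show ?thesis
    unfolding subvec_def by (rule continuous_on_vec_lambda)
qed

lemma continuous_on_monomial_at: "continuous_on A (monomial_at \<alpha>)"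
  unfolding monomial_at_def by (intro continuous_intros)

lemma compact_graph_hull:
  assumes "compact S"
  shows "compact (graph_hull S \<alpha>)"
proof -
  have "{(subvec (Poly_Mapping.keys \<alpha>) x, monomial_at \<alpha> x) |x. x \<in> S}
      = (\<lambda>x. (subvec (Poly_Mapping.keys \<alpha>) x, monomial_at \<alpha> x)) ` S"
    by auto
  then show ?thesis
    unfolding graph_hull_def using assms
    by (auto intro!: compact_convex_hull compact_continuous_image continuous_on_Pair
        continuous_on_subvec continuous_on_monomial_at)
qed

text \<open>As \<open>w\<close> is a function on all exponents, only its objective value is
  recorded, which keeps the set finite-dimensional. Keeping \<open>x\<close> beside it lets the
  induction couple each new value of \<open>w\<close> to the same point.\<close>

lemma compact_relaxation:
  assumes "finite K" "compact S"
  shows "compact {(x, \<Sum>\<alpha>\<in>K. c \<alpha> * w \<alpha>) |x w.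
    x \<in> S \<and> (\<forall>\<alpha>\<in>K. (subvec (Poly_Mapping.keys \<alpha>) x, w \<alpha>) \<in> graph_hull S \<alpha>)}"
  using assms(1)
proof (induction K rule: finite_induct)
  case empty
  have "{(x, \<Sum>\<alpha>\<in>{}. c \<alpha> * w \<alpha>) |x w. x \<in> S \<and> (\<forall>\<alpha>\<in>{}. (subvec (Poly_Mapping.keys \<alpha>) x, w \<alpha>) \<in> graph_hull S \<alpha>)}
     = S \<times> {0 :: real}"
    by auto
  then show ?case
    using assms(2) by (simp add: compact_Times)
next
  case (insert a K)
  let ?F = "\<lambda>K. {(x, \<Sum>\<alpha>\<in>K. c \<alpha> * w \<alpha>) |x w.
    x \<in> S \<and> (\<forall>\<alpha>\<in>K. (subvec (Poly_Mapping.keys \<alpha>) x, w \<alpha>) \<in> graph_hull S \<alpha>)}"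
  \<comment> \<open>A feasible pair for \<open>K\<close> is glued to a point of the new hull over
    the same subvector of \<open>x\<close>: a closed condition on a compact product.\<close>
  define G where "G = (?F K \<times> graph_hull S a) \<inter> {u. subvec (Poly_Mapping.keys a) (fst (fst u)) = fst (snd u)}"
  have "closed {u :: ((real ^ 'a) \<times> real) \<times> ((real ^ 'a) \<times> real).
      subvec (Poly_Mapping.keys a) (fst (fst u)) = fst (snd u)}"
    by (intro closed_Collect_eq continuous_on_compose2[OF continuous_on_subvec] continuous_intros) auto
  then have "compact G"
    unfolding G_def using insert.IH assms(2)
    by (intro compact_Int_closed compact_Times compact_graph_hull)
  then have "compact ((\<lambda>u. (fst (fst u), snd (fst u) + c a * snd (snd u))) ` G)"
    by (rule compact_continuous_image[rotated]) (intro continuous_intros)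
  also have "(\<lambda>u. (fst (fst u), snd (fst u) + c a * snd (snd u))) ` G = ?F (insert a K)"
  proof (intro equalityI subsetI)
    fix v assume "v \<in> (\<lambda>u. (fst (fst u), snd (fst u) + c a * snd (snd u))) ` G"
    then obtain x w b where v: "v = (x, (\<Sum>\<alpha>\<in>K. c \<alpha> * w \<alpha>) + c a * b)" and x: "x \<in> S"
      and w: "\<forall>\<alpha>\<in>K. (subvec (Poly_Mapping.keys \<alpha>) x, w \<alpha>) \<in> graph_hull S \<alpha>"
      and b: "(subvec (Poly_Mapping.keys a) x, b) \<in> graph_hull S a"
      unfolding G_def by auto
    \<comment> \<open>Resetting \<open>w\<close> at \<open>a\<close> does not affect
      \<open>K\<close>, as \<open>a\<close> is not in \<open>K\<close>.\<close>
    have "(\<Sum>\<alpha>\<in>K. c \<alpha> * (w(a := b)) \<alpha>) = (\<Sum>\<alpha>\<in>K. c \<alpha> * w \<alpha>)"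
      using insert.hyps by (intro sum.cong) auto
    then have "v = (x, \<Sum>\<alpha>\<in>insert a K. c \<alpha> * (w(a := b)) \<alpha>)"
      using v insert.hyps by simp
    moreover have "\<forall>\<alpha>\<in>insert a K. (subvec (Poly_Mapping.keys \<alpha>) x, (w(a := b)) \<alpha>) \<in> graph_hull S \<alpha>"
      using w b by auto
    ultimately show "v \<in> ?F (insert a K)"
      using x by blast
  next
    fix v assume "v \<in> ?F (insert a K)"
    then obtain x w where v: "v = (x, \<Sum>\<alpha>\<in>insert a K. c \<alpha> * w \<alpha>)" and x: "x \<in> S"
      and w: "\<forall>\<alpha>\<in>insert a K. (subvec (Poly_Mapping.keys \<alpha>) x, w \<alpha>) \<in> graph_hull S \<alpha>"
      by blast
    then have "((x, \<Sum>\<alpha>\<in>K. c \<alpha> * w \<alpha>), (subvec (Poly_Mapping.keys a) x, w a)) \<in> G"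
      unfolding G_def by auto
    then show "v \<in> (\<lambda>u. (fst (fst u), snd (fst u) + c a * snd (snd u))) ` G"
      using v insert.hyps by (auto intro!: image_eqI[rotated])
  qed
  finally show ?case .
qed

lemma Least_compact:
  fixes A :: "real set"
  assumes "compact A" "A \<noteq> {}"
  shows "(LEAST z. z \<in> A) \<in> A" "\<And>z. z \<in> A \<Longrightarrow> (LEAST z. z \<in> A) \<le> z"
proof -
  obtain s where s: "s \<in> A" "\<forall>t\<in>A. s \<le> t"
    using compact_attains_inf[OF assms] by blast
  then have "(LEAST z. z \<in> A) = s"
    by (intro Least_equality) auto
  then show "(LEAST z. z \<in> A) \<in> A" "\<And>z. z \<in> A \<Longrightarrow> (LEAST z. z \<in> A) \<le> z"
    using s by auto
qed

lemma z_opt_le: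
  assumes "compact S" "x \<in> S"
  shows "z_opt S p \<le> poly_at p x"
proof -
  have "compact (poly_at p ` S)"
    using assms(1) unfolding poly_at_def
    by (intro compact_continuous_image continuous_intros continuous_on_monomial_at)
  moreover have "{poly_at p x |x. x \<in> S} = poly_at p ` S"
    by auto
  ultimately show ?thesis
    unfolding z_opt_def using assms by (intro Least_compact) auto
qed

text \<open>The objective values are the second projection of the compact set in
  \<open>compact_relaxation\<close>; the choice \<open>w \<alpha> = monomial_at \<alpha> x\<close>
  shows that there are some.\<close>

lemma z_mono_attained:
  assumes "compact S" "S \<noteq> {}"
  obtains x w where "x \<in> S"
    "\<And>\<alpha>. \<alpha> \<in> Poly_Mapping.keys p \<Longrightarrow> (subvec (Poly_Mapping.keys \<alpha>) x, w \<alpha>) \<in> graph_hull S \<alpha>"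
    "z_mono S p = (\<Sum>\<alpha>\<in>Poly_Mapping.keys p. Poly_Mapping.lookup p \<alpha> * w \<alpha>)"
proof -
  let ?F = "{(x, \<Sum>\<alpha>\<in>Poly_Mapping.keys p. Poly_Mapping.lookup p \<alpha> * w \<alpha>) |x w.
    x \<in> S \<and> (\<forall>\<alpha>\<in>Poly_Mapping.keys p. (subvec (Poly_Mapping.keys \<alpha>) x, w \<alpha>) \<in> graph_hull S \<alpha>)}"
  let ?V = "{\<Sum>\<alpha>\<in>Poly_Mapping.keys p. Poly_Mapping.lookup p \<alpha> * w \<alpha> |x w.
    x \<in> S \<and> (\<forall>\<alpha>\<in>Poly_Mapping.keys p. (subvec (Poly_Mapping.keys \<alpha>) x, w \<alpha>) \<in> graph_hull S \<alpha>)}"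
  have "compact (snd ` ?F)"
    using assms(1) by (intro compact_continuous_image compact_relaxation continuous_intros) auto
  moreover have "?V = snd ` ?F"
    by force
  ultimately have "compact ?V"
    by simp
  moreover have "?V \<noteq> {}"
  proof -
    obtain x where "x \<in> S"
      using assms(2) by blast
    then have "(subvec (Poly_Mapping.keys \<alpha>) x, monomial_at \<alpha> x) \<in> graph_hull S \<alpha>" for \<alpha>
      unfolding graph_hull_def by (intro hull_inc) auto
    with \<open>x \<in> S\<close> have "(\<Sum>\<alpha>\<in>Poly_Mapping.keys p. Poly_Mapping.lookup p \<alpha> * monomial_at \<alpha> x) \<in> ?V"
      by (intro CollectI exI[of _ x] exI[of _ "\<lambda>\<alpha>. monomial_at \<alpha> x"]) simp
    then show ?thesis
      by blast
  qed
  ultimately have "z_mono S p \<in> ?V"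
    unfolding z_mono_def by (rule Least_compact)
  then show ?thesis
    using that by blast
qed

section \<open>Counting the monomials\<close>

text \<open>
  An exponent of degree at most \<open>m\<close> becomes a composition of \<open>m\<close> into \<open>CARD('n) + 1\<close> parts by
  appending the slack \<open>m - expo_deg \<alpha>\<close>.
\<close>

lemma expo_deg_le_card:
  shows "finite {\<alpha> :: 'n::finite expo. expo_deg \<alpha> \<le> m}"
    and "card {\<alpha> :: 'n::finite expo. expo_deg \<alpha> \<le> m} \<le> (CARD('n) + m) choose CARD('n)"
proof -
  obtain xs :: "'n list" where xs: "set xs = UNIV" "distinct xs"
    using finite_distinct_list[OF finite] by blast
  have len: "length xs = CARD('n)"
    using distinct_card[OF xs(2)] xs(1) by simp
  define f where "f \<alpha> = map (Poly_Mapping.lookup \<alpha>) xs @ [m - expo_deg \<alpha>]" for \<alpha> :: "'n expo"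
  let ?A = "{\<alpha> :: 'n expo. expo_deg \<alpha> \<le> m}"
  let ?L = "{l :: nat list. length l = CARD('n) + 1 \<and> sum_list l = m}"
  have sub: "f ` ?A \<subseteq> ?L"
    using xs by (auto simp: f_def len expo_deg_def sum_list_distinct_conv_sum_set)
  \<comment> \<open>\<open>xs\<close> lists every variable, so the entries before the slack
    determine \<alpha>.\<close>
  have inj: "inj_on f ?A"
    using xs by (auto simp: f_def inj_on_def poly_mapping_eq_iff fun_eq_iff)
  \<comment> \<open>Stars and bars: with \<open>N = CARD('n) + 1\<close> parts,
    \<open>m + N - 1\<close> is \<open>CARD('n) + m\<close>.\<close>
  have "card ?L = (m + (CARD('n) + 1) - 1) choose m"
    by (rule card_length_sum_list)
  also have "\<dots> = (CARD('n) + m) choose CARD('n)"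
    using binomial_symmetric[of m "CARD('n) + m"] by (simp add: add.commute)
  finally have card: "card ?L = (CARD('n) + m) choose CARD('n)" .
  \<comment> \<open>Infinite sets have \<open>card\<close> 0, so a positive count yields
    finiteness.\<close>
  then have "card ?L > 0"
    by simp
  then have fin: "finite ?L"
    using card_gt_0_iff by blast
  show "finite ?A"
    using finite_imageD[OF finite_subset[OF sub fin] inj] .
  show "card ?A \<le> (CARD('n) + m) choose CARD('n)"
    using card_inj_on_le[OF inj sub fin] card by simp
qed

section \<open>Summing the monomial gaps\<close>

theorem corollary1p3:
  fixes p :: "('n::finite) rpoly" and m :: nat and S :: "(real ^ 'n) set"
  assumes "m \<ge> 2"
    and "degree_at_most m p"
    and "S \<noteq> {}" and "compact S" and "convex S"
    and "S \<subseteq> cbox 0 1"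
  shows "z_opt S p - z_mono S p
    \<le> max_abs_coeff m p * (1 - 1 / real m) * real m powr (1 / (1 - real m))
        * real ((CARD('n) + m) choose CARD('n))"
proof -
  let ?K = "Poly_Mapping.keys p"
  let ?c = "Poly_Mapping.lookup p"
  let ?E = "{\<alpha> :: 'n expo. expo_deg \<alpha> \<le> m}"
  define C where "C = (1 - 1 / real m) * real m powr (1 / (1 - real m))"
  have "C \<ge> 0"
    unfolding C_def using assms(1) by (intro mult_nonneg_nonneg) auto
  obtain x w where x: "x \<in> S"
    and w: "\<And>\<alpha>. \<alpha> \<in> ?K \<Longrightarrow> (subvec (Poly_Mapping.keys \<alpha>) x, w \<alpha>) \<in> graph_hull S \<alpha>"
    and z: "z_mono S p = (\<Sum>\<alpha>\<in>?K. ?c \<alpha> * w \<alpha>)"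
    using z_mono_attained[OF assms(4,3)] by blast
  have coeff: "\<bar>?c \<alpha>\<bar> \<le> max_abs_coeff m p" if "\<alpha> \<in> ?E" for \<alpha>
  proof -
    have "{\<bar>?c \<alpha>\<bar> |\<alpha>. expo_deg \<alpha> \<le> m} = (\<lambda>\<alpha>. \<bar>?c \<alpha>\<bar>) ` ?E"
      by auto
    then show ?thesis
      unfolding max_abs_coeff_def using that expo_deg_le_card(1)[of m] by (intro Max_ge) auto
  qed
  have K: "?K \<subseteq> ?E"
    using assms(2) by (auto simp: degree_at_most_def)
  \<comment> \<open>The exponent 0 lies in \<open>?E\<close> for every \<open>p\<close>, so the
    maximum dominates some absolute value even when \<open>p\<close> is zero.\<close>
  have "0 \<in> ?E"
    by (simp add: expo_deg_def)
  then have M: "0 \<le> max_abs_coeff m p"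
    using coeff[of 0] abs_ge_zero order_trans by blast
  \<comment> \<open>The point \<open>x\<close> of the relaxed minimiser is feasible for the original
    problem.\<close>
  have "z_opt S p - z_mono S p \<le> poly_at p x - z_mono S p"
    using z_opt_le[OF assms(4) x] by simp
  also have "\<dots> = (\<Sum>\<alpha>\<in>?K. ?c \<alpha> * (monomial_at \<alpha> x - w \<alpha>))"
    unfolding z poly_at_def by (simp add: right_diff_distrib sum_subtractf)
  also have "\<dots> \<le> (\<Sum>\<alpha>\<in>?K. max_abs_coeff m p * C)"
  proof (rule sum_mono)
    fix \<alpha> assume \<alpha>: "\<alpha> \<in> ?K"
    \<comment> \<open>The sign of the coefficient decides whether under- or overestimation counts,
      hence the two-sided bound.\<close>
    then have "\<bar>monomial_at \<alpha> x - w \<alpha>\<bar> \<le> C"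
      unfolding C_def using K x w assms(1,6) by (intro graph_hull_gap) auto
    then have "\<bar>?c \<alpha> * (monomial_at \<alpha> x - w \<alpha>)\<bar> \<le> max_abs_coeff m p * C"
      unfolding abs_mult using K \<alpha> coeff M by (intro mult_mono) auto
    then show "?c \<alpha> * (monomial_at \<alpha> x - w \<alpha>) \<le> max_abs_coeff m p * C"
      by linarith
  qed
  also have "\<dots> = max_abs_coeff m p * C * real (card ?K)"
    by simp
  also have "\<dots> \<le> max_abs_coeff m p * C * real ((CARD('n) + m) choose CARD('n))"
    using card_mono[OF expo_deg_le_card(1) K] expo_deg_le_card(2)[of m, where 'n='n] M \<open>C \<ge> 0\<close>
    by (intro mult_left_mono) auto
  finally show ?thesis
    unfolding C_def by (simp add: mult.assoc)
qed

end
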